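(* Let $\mathbf t=(t_0,u_0,t_1,u_1)\in\mathbb C^4$ be generic (in the sense specified in the context), and let $\mathbf t^\sigma=(u_1,u_0,t_1,t_0)$. The assignments $$T_0\mapsto-(T_1^\sigma+z),\qquad T_1\mapsto T_1^\sigma,\qquad z\mapsto-(T_0^\sigma+T_1^\sigma)$$ extend uniquely to an algebra isomorphism $\sigma:\mathcal H(\mathbf t)\to\mathcal H(\mathbf t^\sigma)$, respectively to an algebra anti-isomorphism $\psi:\mathcal H(\mathbf t)\to\mathcal H(\mathbf t^\sigma)$. Their inverses are $\sigma^{-1}=\sigma_\sigma$ and $\psi^{-1}=\psi_\sigma$, where $\sigma_\sigma,\psi_\sigma:\mathcal H(\mathbf t^\sigma)\to\mathcal H(\mathbf t)$ denote the corresponding maps obtained by replacing $\mathbf t$ by $\mathbf t^\sigma$, i.e. the (anti-)homomorphic extensions of $T_0^\sigma\mapsto-(T_1+z)$, $T_1^\sigma\mapsto T_1$, $z\mapsto-(T_0+T_1)$.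
   Context: $\mathbb N=\{1,2,\dots\}$; $\mathcal A=\mathbb C[x]$. For $\mathbf t=(t_0,u_0,t_1,u_1)$ define operators $T_i=T_i(\mathbf t)$ on $\mathcal A$ by $$(T_0f)(x)=t_0f(x)+\frac{(t_0+u_0+\frac12-x)(t_0-u_0+\frac12-x)}{1-2x}\big(f(1-x)-f(x)\big),$$ $$(T_1f)(x)=t_1f(x)+\frac{(t_1+u_1+x)(t_1-u_1+x)}{2x}\big(f(-x)-f(x)\big),$$ and let $z$ be multiplication by $x$. $\mathcal H(\mathbf t)\subset\mathrm{End}(\mathcal A)$ is the unital subalgebra generated by $T_0(\mathbf t),T_1(\mathbf t),z$. Write $T_i^\sigma=T_i(\mathbf t^\sigma)$. Generic means, with $(a,b,c,d)=(t_1+u_1,t_1-u_1,t_0+u_0+\frac12,t_0-u_0+\frac12)$: $t_0,t_1\ne0$; $t_0+t_1\notin-\frac12\mathbb N$; $a,b,c,d\notin-\frac12\mathbb Z_{\ge0}$; no sum of two of $a,b,c,d$ (at distinct positions) lies in $\mathbb Z$. *)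

theory Defs
  imports Complex_Main "HOL-Computational_Algebra.Polynomial"
begin

text \<open>Parameters \<open>t = (t0, u0, t1, u1)\<close>. The algebra of polynomials is \<^typ>\<open>complex poly\<close>.\<close>

type_synonym params = "complex \<times> complex \<times> complex \<times> complex"

type_synonym operator = "complex poly \<Rightarrow> complex poly"

text \<open>The polynomial divisions below are exact (lemmas \<open>T0_div_exact\<close> and \<open>T1_div_exact\<close>), so
  these are the usual difference-reflection operators; see \<open>poly_T0\<close> and \<open>poly_T1\<close>.\<close>

fun T0 :: "params \<Rightarrow> operator" where
  "T0 (t0, u0, t1, u1) f =
     smult t0 f + [:t0 + u0 + 1/2, -1:] * [:t0 - u0 + 1/2, -1:]
       * ((f \<circ>\<^sub>p [:1, -1:] - f) div [:1, -2:])"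

fun T1 :: "params \<Rightarrow> operator" where
  "T1 (t0, u0, t1, u1) f =
     smult t1 f + [:t1 + u1, 1:] * [:t1 - u1, 1:]
       * ((f \<circ>\<^sub>p [:0, -1:] - f) div [:0, 2:])"

definition Z :: operator where
  "Z f = [:0, 1:] * f"

lemma T0_div_exact: "[:1, -2:] dvd (f \<circ>\<^sub>p [:1, -1:] - f)" for f :: "complex poly"
proof -
  have "[:- (1/2), 1:] dvd (f \<circ>\<^sub>p [:1, -1:] - f)"
    by (simp add: poly_eq_0_iff_dvd[symmetric] poly_pcompose)
  moreover have "[:1, -2:] = smult (-2) [:- (1/2), 1 :: complex:]" by simp
  ultimately show ?thesis by (metis smult_dvd_iff neg_equal_0_iff_equal zero_neq_numeral)
qed

lemma T1_div_exact: "[:0, 2:] dvd (f \<circ>\<^sub>p [:0, -1:] - f)" for f :: "complex poly"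
proof -
  have "[:- 0, 1:] dvd (f \<circ>\<^sub>p [:0, -1:] - f)"
    by (subst poly_eq_0_iff_dvd[symmetric]) (simp add: poly_pcompose)
  moreover have "[:0, 2:] = smult 2 [:- 0, 1 :: complex:]" by simp
  ultimately show ?thesis by (metis smult_dvd_iff zero_neq_numeral)
qed

lemma poly_T0:
  assumes "x \<noteq> 1/2"
  shows "poly (T0 (t0, u0, t1, u1) f) x =
    t0 * poly f x + (t0 + u0 + 1/2 - x) * (t0 - u0 + 1/2 - x) / (1 - 2 * x)
      * (poly f (1 - x) - poly f x)"
proof -
  define q where "q = (f \<circ>\<^sub>p [:1, -1:] - f) div [:1, -2:]"
  have "f \<circ>\<^sub>p [:1, -1:] - f = [:1, -2:] * q"
    unfolding q_def using T0_div_exact by (metis dvd_mult_div_cancel)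
  then have "poly (f \<circ>\<^sub>p [:1, -1:] - f) x = poly ([:1, -2:] * q) x" by (rule arg_cong)
  then have "poly f (1 - x) - poly f x = (1 - 2 * x) * poly q x"
    by (simp add: poly_pcompose algebra_simps)
  moreover have "1 - 2 * x \<noteq> 0" using assms by (simp add: field_simps)
  ultimately have q: "(poly f (1 - x) - poly f x) / (1 - 2 * x) = poly q x" by simp
  have "poly (T0 (t0, u0, t1, u1) f) x =
      t0 * poly f x + (t0 + u0 + 1/2 - x) * (t0 - u0 + 1/2 - x) * poly q x"
    by (simp add: q_def[symmetric] del: mult_pCons_left mult_pCons_right)
  then show ?thesis unfolding q[symmetric] by simp
qed

lemma poly_T1:
  assumes "x \<noteq> 0"
  shows "poly (T1 (t0, u0, t1, u1) f) x =
    t1 * poly f x + (t1 + u1 + x) * (t1 - u1 + x) / (2 * x) * (poly f (- x) - poly f x)"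
proof -
  define q where "q = (f \<circ>\<^sub>p [:0, -1:] - f) div [:0, 2:]"
  have "f \<circ>\<^sub>p [:0, -1:] - f = [:0, 2:] * q"
    unfolding q_def using T1_div_exact by (metis dvd_mult_div_cancel)
  then have "poly (f \<circ>\<^sub>p [:0, -1:] - f) x = poly ([:0, 2:] * q) x" by (rule arg_cong)
  then have "poly f (- x) - poly f x = 2 * x * poly q x"
    by (simp add: poly_pcompose algebra_simps)
  with assms have q: "(poly f (- x) - poly f x) / (2 * x) = poly q x" by simp
  have "poly (T1 (t0, u0, t1, u1) f) x =
      t1 * poly f x + (t1 + u1 + x) * (t1 - u1 + x) * poly q x"
    by (simp add: q_def[symmetric] del: mult_pCons_left mult_pCons_right)
  then show ?thesis unfolding q[symmetric] by simp
qed

inductive_set subalgebra_generated :: "operator set \<Rightarrow> operator set" for G where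
  gen: "X \<in> G \<Longrightarrow> X \<in> subalgebra_generated G"
| one: "id \<in> subalgebra_generated G"
| add: "X \<in> subalgebra_generated G \<Longrightarrow> Y \<in> subalgebra_generated G \<Longrightarrow>
    (\<lambda>f. X f + Y f) \<in> subalgebra_generated G"
| scale: "X \<in> subalgebra_generated G \<Longrightarrow> (\<lambda>f. smult c (X f)) \<in> subalgebra_generated G"
| mult: "X \<in> subalgebra_generated G \<Longrightarrow> Y \<in> subalgebra_generated G \<Longrightarrow>
    X \<circ> Y \<in> subalgebra_generated G"

definition H :: "params \<Rightarrow> operator set" where
  "H t = subalgebra_generated {T0 t, T1 t, Z}"

text \<open>The elements of \<^term>\<open>H t\<close> are linear, so \<^term>\<open>H t\<close> is a subalgebra of the endomorphism
  algebra of \<^typ>\<open>complex poly\<close>.\<close>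

lemma H_linear:
  assumes "X \<in> H t"
  shows "X (f + g) = X f + X g" and "X (smult c f) = smult c (X f)"
proof -
  have *: "q * ((smult c p) div r) = smult c (q * (p div r))" for c and p q r :: "complex poly"
    by (simp only: div_smult_left mult_smult_right)
  have pc: "(f + g) \<circ>\<^sub>p q - (f + g) = (f \<circ>\<^sub>p q - f) + (g \<circ>\<^sub>p q - g)"
    "(smult c f) \<circ>\<^sub>p q - smult c f = smult c (f \<circ>\<^sub>p q - f)" for f g q :: "complex poly" and c
    by (simp_all only: pcompose_add pcompose_smult smult_diff_right add_diff_add)
  have sc: "smult s (smult c p) = smult c (smult s p)" for s c and p :: "complex poly"
    by (simp add: mult.commute)
  obtain t0 u0 t1 u1 where t: "t = (t0, u0, t1, u1)" by (cases t)
  have T0: "T0 t (f + g) = T0 t f + T0 t g" "T0 t (smult c f) = smult c (T0 t f)" for f g c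
    by (simp_all only: t T0.simps pc poly_div_add_left * sc smult_add_right distrib_left add.assoc add.commute add.left_commute)
  have T1: "T1 t (f + g) = T1 t f + T1 t g" "T1 t (smult c f) = smult c (T1 t f)" for f g c
    by (simp_all only: t T1.simps pc poly_div_add_left * sc smult_add_right distrib_left add.assoc add.commute add.left_commute)
  have Z: "Z (f + g) = Z f + Z g" "Z (smult c f) = smult c (Z f)" for f g c
    by (simp_all add: Z_def distrib_left)
  have "(\<forall>f g. X (f + g) = X f + X g) \<and> (\<forall>c f. X (smult c f) = smult c (X f))"
    using assms unfolding H_def
    by (induction rule: subalgebra_generated.induct)
       (auto simp: T0 T1 Z smult_add_right mult.commute)
  then show "X (f + g) = X f + X g" and "X (smult c f) = smult c (X f)" by auto
qed

fun generic :: "params \<Rightarrow> bool" where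
  "generic (t0, u0, t1, u1) \<longleftrightarrow>
     (let a = t1 + u1; b = t1 - u1; c = t0 + u0 + 1/2; d = t0 - u0 + 1/2 in
        t0 \<noteq> 0 \<and> t1 \<noteq> 0 \<and>
        t0 + t1 \<notin> {- of_nat n / 2 | n. n \<ge> 1} \<and>
        (\<forall>e \<in> {a, b, c, d}. e \<notin> {- of_nat n / 2 | n. True}) \<and>
        a + b \<notin> \<int> \<and> a + c \<notin> \<int> \<and> a + d \<notin> \<int> \<and> b + c \<notin> \<int> \<and> b + d \<notin> \<int> \<and> c + d \<notin> \<int>)"

fun dual :: "params \<Rightarrow> params" where
  "dual (t0, u0, t1, u1) = (u1, u0, t1, t0)"

text \<open>Maps between subalgebras are total functions on operators; only their values on the
  source subalgebra are relevant.\<close>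

definition algebra_linear :: "operator set \<Rightarrow> operator set \<Rightarrow> (operator \<Rightarrow> operator) \<Rightarrow> bool" where
  "algebra_linear A B \<phi> \<longleftrightarrow>
     \<phi> ` A \<subseteq> B \<and> \<phi> id = id \<and>
     (\<forall>X\<in>A. \<forall>Y\<in>A. \<phi> (\<lambda>f. X f + Y f) = (\<lambda>f. \<phi> X f + \<phi> Y f)) \<and>
     (\<forall>c. \<forall>X\<in>A. \<phi> (\<lambda>f. smult c (X f)) = (\<lambda>f. smult c (\<phi> X f)))"

definition algebra_hom :: "operator set \<Rightarrow> operator set \<Rightarrow> (operator \<Rightarrow> operator) \<Rightarrow> bool" where
  "algebra_hom A B \<phi> \<longleftrightarrow>
     algebra_linear A B \<phi> \<and> (\<forall>X\<in>A. \<forall>Y\<in>A. \<phi> (X \<circ> Y) = \<phi> X \<circ> \<phi> Y)"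

definition algebra_antihom :: "operator set \<Rightarrow> operator set \<Rightarrow> (operator \<Rightarrow> operator) \<Rightarrow> bool" where
  "algebra_antihom A B \<phi> \<longleftrightarrow>
     algebra_linear A B \<phi> \<and> (\<forall>X\<in>A. \<forall>Y\<in>A. \<phi> (X \<circ> Y) = \<phi> Y \<circ> \<phi> X)"

definition algebra_iso :: "operator set \<Rightarrow> operator set \<Rightarrow> (operator \<Rightarrow> operator) \<Rightarrow> bool" where
  "algebra_iso A B \<phi> \<longleftrightarrow> algebra_hom A B \<phi> \<and> bij_betw \<phi> A B"

definition algebra_antiiso :: "operator set \<Rightarrow> operator set \<Rightarrow> (operator \<Rightarrow> operator) \<Rightarrow> bool" where
  "algebra_antiiso A B \<phi> \<longleftrightarrow> algebra_antihom A B \<phi> \<and> bij_betw \<phi> A B"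

definition duality_values :: "params \<Rightarrow> (operator \<Rightarrow> operator) \<Rightarrow> bool" where
  "duality_values t \<phi> \<longleftrightarrow>
     \<phi> (T0 t) = (\<lambda>f. - (T1 (dual t) f + Z f)) \<and>
     \<phi> (T1 t) = T1 (dual t) \<and>
     \<phi> Z = (\<lambda>f. - (T0 (dual t) f + T1 (dual t) f))"

text \<open>Uniqueness is among all (anti-)homomorphic extensions, not only the bijective ones. Since
  \<^term>\<open>dual (dual t) = t\<close>, the maps for \<^term>\<open>dual t\<close> go back into \<^term>\<open>H t\<close>.\<close>

definition unique_hom_extension :: "params \<Rightarrow> (operator \<Rightarrow> operator) \<Rightarrow> bool" where
  "unique_hom_extension t \<phi> \<longleftrightarrow>
     algebra_hom (H t) (H (dual t)) \<phi> \<and> duality_values t \<phi> \<and>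
     (\<forall>\<phi>'. algebra_hom (H t) (H (dual t)) \<phi>' \<and> duality_values t \<phi>' \<longrightarrow> (\<forall>X\<in>H t. \<phi>' X = \<phi> X))"

definition unique_antihom_extension :: "params \<Rightarrow> (operator \<Rightarrow> operator) \<Rightarrow> bool" where
  "unique_antihom_extension t \<phi> \<longleftrightarrow>
     algebra_antihom (H t) (H (dual t)) \<phi> \<and> duality_values t \<phi> \<and>
     (\<forall>\<phi>'. algebra_antihom (H t) (H (dual t)) \<phi>' \<and> duality_values t \<phi>' \<longrightarrow>
        (\<forall>X\<in>H t. \<phi>' X = \<phi> X))"

end

theory Submission
  imports Defs "HOL-Library.Product_Plus"
begin

text \<open>The generators satisfy \<open>T0\<^sup>2 = t0\<^sup>2\<close>, \<open>T1\<^sup>2 = t1\<^sup>2\<close>, \<open>(T0 + 1/2 - z)\<^sup>2 = u0\<^sup>2\<close>,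
  \<open>(T1 + z)\<^sup>2 = u1\<^sup>2\<close>. The duality interchanges \<open>T0\<close> with \<open>- (T1 + z)\<close> and fixes \<open>T1\<close> and
  \<open>T0 + 1/2 - z\<close>, so it maps these relations to those for the dual parameters; as only squares
  occur, the same holds for the antihomomorphism. It remains to see that these relations present
  the algebra. They allow every element to be written as a combination of the \<open>z\<^sup>i T\<^sub>w\<close> with \<open>w\<close> a
  word in \<open>T0, T1\<close> without repeated adjacent letters, and these operators are linearly independent:
  \<open>(T\<^sub>w f)(x)\<close> involves \<open>f\<close> at the point \<open>w x\<close> of the orbit of \<open>x\<close> under \<open>x \<mapsto> - x\<close>,
  \<open>x \<mapsto> 1 - x\<close> with a nonzero coefficient, when \<open>x\<close> has large imaginary part. The homomorphism is
  obtained from its graph, the algebra generated by the pairs of corresponding generators.\<close>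

section \<open>Algebras satisfying the relations\<close>

instantiation prod :: (times, times) times
begin
definition times_prod :: "'a \<times> 'b \<Rightarrow> 'a \<times> 'b \<Rightarrow> 'a \<times> 'b" where
  "times_prod p q = (fst p * fst q, snd p * snd q)"
instance ..
end

instantiation prod :: (one, one) one
begin
definition one_prod :: "'a \<times> 'b" where "one_prod = (1, 1)"
instance ..
end

instance prod :: (ring_1, ring_1) ring_1
  by standard
    (auto simp: times_prod_def one_prod_def zero_prod_def prod_eq_iff algebra_simps)

lemma fst_times [simp]: "fst (p * q) = fst p * fst q"
  and snd_times [simp]: "snd (p * q) = snd p * snd q"
  and fst_one [simp]: "fst 1 = 1"
  and snd_one [simp]: "snd 1 = 1"
  by (simp_all add: times_prod_def one_prod_def)

lemma fst_power [simp]: "fst (p ^ n) = fst p ^ n"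
  for p :: "'a::ring_1 \<times> 'b::ring_1"
  by (induction n) simp_all

text \<open>The map \<open>C\<close> makes the ring a complex algebra. Keeping it a parameter lets
  operators, opposite rings and products satisfy the same axioms, those of a rank-one degenerate
  double affine Hecke algebra.\<close>

locale daha_algebra =
  fixes C :: "complex \<Rightarrow> 'r::ring_1" and \<tau>0 \<tau>1 \<zeta> :: 'r and t0 u0 t1 u1 :: complex
  assumes C_add: "C (a + b) = C a + C b"
    and C_mult: "C (a * b) = C a * C b"
    and C_one: "C 1 = 1"
    and C_commute: "C a * x = x * C a"
    and \<tau>0_square: "\<tau>0 * \<tau>0 = C (t0\<^sup>2)"
    and \<tau>1_square: "\<tau>1 * \<tau>1 = C (t1\<^sup>2)"
    and \<tau>0_\<zeta>_square: "(\<tau>0 + C (1/2) - \<zeta>) * (\<tau>0 + C (1/2) - \<zeta>) = C (u0\<^sup>2)"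
    and \<tau>1_\<zeta>_square: "(\<tau>1 + \<zeta>) * (\<tau>1 + \<zeta>) = C (u1\<^sup>2)"
begin

lemma C_zero: "C 0 = 0"
  using C_add[of 0 0] by simp

lemma C_uminus: "C (- a) = - C a"
  using C_add[of a "- a"] C_zero by (simp add: eq_neg_iff_add_eq_0 add.commute)

lemma C_left_commute: "x * (C a * y) = C a * (x * y)"
  by (metis C_commute mult.assoc)

text \<open>Expanding \<open>\<tau>1_\<zeta>_square\<close> leaves one product in the wrong order;
  used from left to right, the equation moves \<open>\<zeta>\<close> to the left of
  \<open>\<tau>1\<close>.\<close>

lemma \<tau>1_\<zeta>: "\<tau>1 * \<zeta> = C (u1\<^sup>2 - t1\<^sup>2) + C (- 1) * (\<zeta> * \<tau>1) + C (- 1) * (\<zeta> * \<zeta>)"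
proof -
  have "C (u1\<^sup>2 - t1\<^sup>2) = C (u1\<^sup>2) - C (t1\<^sup>2)"
    using C_add[of "u1\<^sup>2" "- (t1\<^sup>2)"] by (simp add: C_uminus)
  then show ?thesis
    by (simp add: \<tau>1_\<zeta>_square[symmetric] \<tau>1_square[symmetric] C_uminus C_one algebra_simps)
qed

lemma \<tau>0_\<zeta>:
  "\<tau>0 * \<zeta> = C (t0\<^sup>2 + 1/4 - u0\<^sup>2) + \<tau>0 + C (- 1) * \<zeta> + C (- 1) * (\<zeta> * \<tau>0) + \<zeta> * \<zeta>"
proof -
  have 1: "C (1/2) * C (1/2) = C (1/4)"
    by (simp add: C_mult[symmetric])
  have 2: "C (1/2) * x + C (1/2) * x = x" for x
    by (simp add: C_add[symmetric] distrib_right[symmetric] C_one)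
  have "C (t0\<^sup>2 + 1/4 - u0\<^sup>2) = C (t0\<^sup>2) + C (1/4) - C (u0\<^sup>2)"
    using C_add[of "t0\<^sup>2 + 1/4" "- (u0\<^sup>2)"] by (simp add: C_uminus C_add)
  moreover have "C (u0\<^sup>2) = \<tau>0 * \<tau>0 + C (1/4) + \<zeta> * \<zeta> - \<tau>0 * \<zeta> - \<zeta> * \<tau>0
      + (C (1/2) * \<tau>0 + C (1/2) * \<tau>0) - (C (1/2) * \<zeta> + C (1/2) * \<zeta>)"
    unfolding \<tau>0_\<zeta>_square[symmetric] 
    by (simp add: algebra_simps 1 C_commute[of "1/2" \<tau>0] C_commute[of "1/2" \<zeta>])
  ultimately show ?thesis
    by (simp add: 2 \<tau>0_square C_uminus C_one algebra_simps)
qed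

text \<open>The letter \<^const>\<open>True\<close> stands for \<open>\<tau>1\<close> and \<^const>\<open>False\<close> for \<open>\<tau>0\<close>.\<close>

fun word :: "bool list \<Rightarrow> 'r" where
  "word [] = 1"
| "word (b # w) = (if b then \<tau>1 else \<tau>0) * word w"

definition monomial :: "nat \<times> bool list \<Rightarrow> 'r" where
  "monomial k = \<zeta> ^ fst k * word (snd k)"

inductive_set algebra :: "'r set" where
  \<tau>0: "\<tau>0 \<in> algebra"
| \<tau>1: "\<tau>1 \<in> algebra"
| \<zeta>: "\<zeta> \<in> algebra"
| scalar: "C c \<in> algebra"
| add: "x \<in> algebra \<Longrightarrow> y \<in> algebra \<Longrightarrow> x + y \<in> algebra"
| mult: "x \<in> algebra \<Longrightarrow> y \<in> algebra \<Longrightarrow> x * y \<in> algebra"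

text \<open>\<open>distinct_adj\<close> makes \<open>w\<close> alternate, so these are the reduced
  words of the infinite dihedral group. Monomials may repeat, which makes closure under addition
  immediate.\<close>

inductive_set normal :: "'r set" where
  zero: "0 \<in> normal"
| step: "x \<in> normal \<Longrightarrow> distinct_adj w \<Longrightarrow> C c * monomial (i, w) + x \<in> normal"

lemma normal_monomial: "distinct_adj w \<Longrightarrow> C c * monomial (i, w) \<in> normal"
  using normal.step[OF normal.zero] by simp

lemma normal_add:
  assumes "x \<in> normal" "y \<in> normal"
  shows "x + y \<in> normal"
  using assms by induction (auto simp: add.assoc intro: normal.intros)

lemma normal_scale:
  assumes "x \<in> normal"
  shows "C c * x \<in> normal"
  using assms
  by induction
    (auto simp: distrib_left mult.assoc[symmetric] C_mult[symmetric] intro: normal.intros)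

lemma normal_\<zeta>:
  assumes "x \<in> normal"
  shows "\<zeta> * x \<in> normal"
  using assms
proof induction
  case zero
  show ?case by (simp add: normal.zero)
next
  case (step x w c i)
  have "\<zeta> * (C c * monomial (i, w)) = C c * monomial (Suc i, w)"
    by (simp add: monomial_def C_left_commute mult.assoc)
  then show ?case using step normal.step[of "\<zeta> * x" w c "Suc i"] by (simp add: distrib_left)
qed

text \<open>If \<open>w\<close> begins with \<open>b\<close>, the square relation turns the two
  equal letters into a scalar; otherwise the longer word still alternates.\<close>

lemma normal_\<tau>_word:
  assumes "distinct_adj w"
  shows "(if b then \<tau>1 else \<tau>0) * word w \<in> normal"
proof (cases "\<exists>v. w = b # v")
  case True
  then obtain v where w: "w = b # v" by blast
  have "(if b then \<tau>1 else \<tau>0) * word w = C (if b then t1\<^sup>2 else t0\<^sup>2) * monomial (0, v)"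
    by (simp add: w monomial_def mult.assoc[symmetric] \<tau>0_square \<tau>1_square)
  moreover have "distinct_adj v" using assms by (cases v) (auto simp: w)
  ultimately show ?thesis by (simp only: normal_monomial)
next
  case False
  then have "distinct_adj (b # w)" using assms by (cases w) auto
  from normal_monomial[OF this, of 1 0] show ?thesis
    by (simp add: monomial_def C_one)
qed

text \<open>Induction on the exponent of \<open>\<zeta>\<close>: the commutation relations carry the
  letter past one factor \<open>\<zeta>\<close>, after which it only acts on the monomial of lower
  degree.\<close>

lemma normal_\<tau>_monomial:
  assumes "distinct_adj w"
  shows "(if b then \<tau>1 else \<tau>0) * monomial (i, w) \<in> normal"
proof (induction i)
  case 0
  show ?case using normal_\<tau>_word[OF assms, of b] by (simp add: monomial_def)
next
  case (Suc i)
  define m where "m = monomial (i, w)"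
  have m: "m \<in> normal" "monomial (Suc i, w) = \<zeta> * m"
    using normal_monomial[OF assms, of 1 i] by (simp_all add: C_one m_def monomial_def mult.assoc)
  show ?case
  proof (cases b)
    case True
    have "\<tau>1 * (\<zeta> * m) = C (u1\<^sup>2 - t1\<^sup>2) * m + C (- 1) * (\<zeta> * (\<tau>1 * m)) + C (- 1) * (\<zeta> * (\<zeta> * m))"
      by (simp only: mult.assoc[symmetric] \<tau>1_\<zeta> distrib_right)
    also have "\<dots> \<in> normal"
      using Suc True m by (auto simp: m_def[symmetric] intro!: normal_add normal_scale normal_\<zeta>)
    finally show ?thesis using True m by simp
  next
    case False
    have "\<tau>0 * (\<zeta> * m) = C (t0\<^sup>2 + 1/4 - u0\<^sup>2) * m + \<tau>0 * m + C (- 1) * (\<zeta> * m)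
        + C (- 1) * (\<zeta> * (\<tau>0 * m)) + \<zeta> * (\<zeta> * m)"
      by (simp only: mult.assoc[symmetric] \<tau>0_\<zeta> distrib_right)
    also have "\<dots> \<in> normal"
      using Suc False m by (auto simp: m_def[symmetric] intro!: normal_add normal_scale normal_\<zeta>)
    finally show ?thesis using False m by simp
  qed
qed

lemma normal_\<tau>:
  assumes "x \<in> normal"
  shows "(if b then \<tau>1 else \<tau>0) * x \<in> normal"
  using assms
proof induction
  case zero
  show ?case by (simp add: normal.zero)
next
  case (step x w c i)
  have "(if b then \<tau>1 else \<tau>0) * (C c * monomial (i, w) + x) =
      C c * ((if b then \<tau>1 else \<tau>0) * monomial (i, w)) + (if b then \<tau>1 else \<tau>0) * x"
    by (simp add: distrib_left C_left_commute)
  then show ?case using step by (simp only: normal_add normal_scale normal_\<tau>_monomial)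
qed

text \<open>Left multiplication by any algebra element preserves \<open>normal\<close>, as it does
  for each generator; applied to 1 it gives the element itself.\<close>

lemma algebra_subset_normal: "algebra \<subseteq> normal"
proof
  fix x assume "x \<in> algebra"
  then have "x * y \<in> normal" if "y \<in> normal" for y
    using that
  proof (induction arbitrary: y)
    case \<tau>0
    then show ?case using normal_\<tau>[of y False] by simp
  next
    case \<tau>1
    then show ?case using normal_\<tau>[of y True] by simp
  qed (simp_all add: distrib_right mult.assoc normal_add normal_scale normal_\<zeta>)
  moreover have "1 \<in> normal"
    using normal_monomial[of "[]" 1 0] by (simp add: monomial_def C_one)
  ultimately show "x \<in> normal" by (metis mult.right_neutral)
qed

lemma normal_sum:
  assumes "x \<in> normal"
  shows "\<exists>F c. finite F \<and> (\<forall>k\<in>F. distinct_adj (snd k)) \<and> x = (\<Sum>k\<in>F. C (c k) * monomial k)"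
  using assms
proof induction
  case zero
  show ?case by (rule exI[of _ "{}"]) simp
next
  case (step x w a i)
  then obtain F c where F: "finite F" "\<forall>k\<in>F. distinct_adj (snd k)"
    and x: "x = (\<Sum>k\<in>F. C (c k) * monomial k)" by blast
  \<comment> \<open>Reading the coefficient as 0 outside \<open>F\<close> treats a new monomial and
    a repeated one alike.\<close>
  define d where "d k = (if k \<in> F then c k else 0) + (if k = (i, w) then a else 0)" for k
  define G where "G = insert (i, w) F"
  have "(\<Sum>k\<in>G. C (d k) * monomial k) =
      (\<Sum>k\<in>G. C (if k \<in> F then c k else 0) * monomial k)
      + (\<Sum>k\<in>G. C (if k = (i, w) then a else 0) * monomial k)"
    by (simp add: d_def C_add distrib_right sum.distrib)
  also have "(\<Sum>k\<in>G. C (if k \<in> F then c k else 0) * monomial k) = x"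
    unfolding x using F(1) by (intro sum.mono_neutral_cong_right) (auto simp: G_def C_zero)
  also have "(\<Sum>k\<in>G. C (if k = (i, w) then a else 0) * monomial k) =
      (\<Sum>k\<in>{(i, w)}. C a * monomial k)"
    using F(1) by (intro sum.mono_neutral_cong_right) (auto simp: G_def C_zero)
  finally have "(\<Sum>k\<in>G. C (d k) * monomial k) = C a * monomial (i, w) + x"
    by (simp add: add.commute)
  moreover have "finite G" "\<forall>k\<in>G. distinct_adj (snd k)"
    using F step by (auto simp: G_def)
  ultimately show ?case by metis
qed

end

section \<open>Linear operators\<close>

text \<open>Composing \<open>X\<close> with a pointwise sum distributes in general only if
  \<open>X\<close> is additive, so the ring consists of linear maps.\<close>

typedef endo = "{X :: operator. (\<forall>f g. X (f + g) = X f + X g) \<and> (\<forall>c f. X (smult c f) = smult c (X f))}"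
  morphisms app endo
  by (rule exI[of _ id]) simp

setup_lifting type_definition_endo

instantiation endo :: ring_1
begin
lift_definition zero_endo :: endo is "\<lambda>f. 0" by simp
lift_definition one_endo :: endo is id by simp
lift_definition plus_endo :: "endo \<Rightarrow> endo \<Rightarrow> endo" is "\<lambda>X Y f. X f + Y f"
  by (simp add: smult_add_right)
lift_definition minus_endo :: "endo \<Rightarrow> endo \<Rightarrow> endo" is "\<lambda>X Y f. X f - Y f"
  by (simp add: smult_diff_right)
lift_definition uminus_endo :: "endo \<Rightarrow> endo" is "\<lambda>X f. - X f"
  by simp
lift_definition times_endo :: "endo \<Rightarrow> endo \<Rightarrow> endo" is "(\<circ>)"
  by simp
instance
proof
  show "(0 :: endo) \<noteq> 1" by transfer (metis id_apply zero_neq_one)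
next
  fix a b c :: endo
  show "a + b + c = a + (b + c)" by transfer (simp add: add.assoc)
  show "a + b = b + a" by transfer (simp add: add.commute)
  show "0 + a = a" by transfer simp
  show "- a + a = 0" by transfer simp
  show "a - b = a + - b" by transfer simp
  show "a * b * c = a * (b * c)" by transfer (simp only: comp_assoc)
  show "1 * a = a" by transfer simp
  show "a * 1 = a" by transfer simp
  show "(a + b) * c = a * c + b * c" by transfer (simp add: fun_eq_iff)
  show "a * (b + c) = a * b + a * c" by transfer (simp add: fun_eq_iff)
qed
end

lift_definition scalar :: "complex \<Rightarrow> endo" is smult
  by (simp add: smult_add_right mult.commute)

lemma app_smult: "app X (smult c f) = smult c (app X f)"
  by (transfer; simp)

lemma app_sum: "app (sum X F) f = (\<Sum>k\<in>F. app (X k) f)"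
  by (induction F rule: infinite_finite_induct) (auto simp: zero_endo.rep_eq plus_endo.rep_eq)

text \<open>An antihomomorphism is a homomorphism into the opposite ring, so one universal property
  serves both duality maps.\<close>

typedef 'a opposite = "UNIV :: 'a set" morphisms unop op ..

setup_lifting type_definition_opposite

instantiation opposite :: (ring_1) ring_1
begin
lift_definition zero_opposite :: "'a opposite" is 0 .
lift_definition one_opposite :: "'a opposite" is 1 .
lift_definition plus_opposite :: "'a opposite \<Rightarrow> 'a opposite \<Rightarrow> 'a opposite" is "(+)" .
lift_definition minus_opposite :: "'a opposite \<Rightarrow> 'a opposite \<Rightarrow> 'a opposite" is "(-)" .
lift_definition uminus_opposite :: "'a opposite \<Rightarrow> 'a opposite" is uminus .
lift_definition times_opposite :: "'a opposite \<Rightarrow> 'a opposite \<Rightarrow> 'a opposite" is "\<lambda>x y. y * x" .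
instance
proof
  fix a b c :: "'a opposite"
  show "a + b + c = a + (b + c)" by transfer (rule add.assoc)
  show "a + b = b + a" by transfer (rule add.commute)
  show "0 + a = a" by transfer simp
  show "- a + a = 0" by transfer simp
  show "a - b = a + - b" by transfer simp
  show "a * b * c = a * (b * c)" by transfer (simp only: mult.assoc)
  show "1 * a = a" by transfer simp
  show "a * 1 = a" by transfer simp
  show "(a + b) * c = a * c + b * c" by transfer (rule distrib_left)
  show "a * (b + c) = a * b + a * c" by transfer (rule distrib_right)
  show "(0 :: 'a opposite) \<noteq> 1" by transfer simp
qed
end

section \<open>The generators as linear operators and their quadratic relations\<close>

lift_definition E0 :: "params \<Rightarrow> endo" is T0
  using H_linear[of "T0 t" t for t] subalgebra_generated.gen[of "T0 t" "{T0 t, T1 t, Z}" for t]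
  by (simp add: H_def)

lift_definition E1 :: "params \<Rightarrow> endo" is T1
  using H_linear[of "T1 t" t for t] subalgebra_generated.gen[of "T1 t" "{T0 t, T1 t, Z}" for t]
  by (simp add: H_def)

lift_definition EZ :: endo is Z
  by (simp add: Z_def distrib_left)

lemma app_E0 [simp]: "app (E0 t) = T0 t"
  and app_E1 [simp]: "app (E1 t) = T1 t"
  and app_EZ [simp]: "app EZ = Z"
  by (simp_all add: E0.rep_eq E1.rep_eq EZ.rep_eq)

lemma app_algebra [simp]:
  "app 0 f = 0" "app 1 f = f" "app (X + Y) f = app X f + app Y f" "app (X - Y) f = app X f - app Y f"
  "app (- X) f = - app X f" "app (X * Y) f = app X (app Y f)" "app (scalar c) f = smult c f"
  by (transfer; simp)+

lemma poly_Z [simp]: "poly (Z f) x = x * poly f x"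
  by (simp add: Z_def)

lemma infinite_Im_greater: "infinite {x. Im x > M}"
proof -
  have "inj (\<lambda>n::nat. \<i> * complex_of_real (\<bar>M\<bar> + 1 + n))"
    by (rule injI) simp
  then have "infinite (range (\<lambda>n::nat. \<i> * complex_of_real (\<bar>M\<bar> + 1 + n)))"
    by (rule range_inj_infinite)
  moreover have "range (\<lambda>n::nat. \<i> * complex_of_real (\<bar>M\<bar> + 1 + n)) \<subseteq> {x. Im x > M}"
    by auto
  ultimately show ?thesis by (rule infinite_super[rotated])
qed

lemma poly_eq_zero_Im_greater:
  assumes "\<And>x. Im x > M \<Longrightarrow> poly p x = 0"
  shows "p = 0"
proof (rule ccontr)
  assume "p \<noteq> 0"
  then have "finite {x. poly p x = 0}" by (rule poly_roots_finite)
  then have "finite {x. Im x > M}" by (rule rev_finite_subset) (use assms in auto)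
  then show False using infinite_Im_greater by blast
qed

text \<open>A polynomial vanishing on a half-plane is zero. The upper half-plane avoids 0 and 1/2,
  where \<open>poly_T1\<close> and \<open>poly_T0\<close> do not apply.\<close>

lemma endo_eqI:
  assumes "\<And>f x. Im x > 0 \<Longrightarrow> poly (app X f) x = poly (app Y f) x"
  shows "X = Y"
proof -
  have "app X f - app Y f = 0" for f
    by (rule poly_eq_zero_Im_greater[of 0]) (simp add: assms)
  then show ?thesis by (simp add: app_inject[symmetric] fun_eq_iff)
qed

text \<open>Each square involves a single reflection, so only the values of \<open>f\<close> at
  \<open>x\<close> and its mirror point occur, and the relation becomes an identity of rational
  functions.\<close>

interpretation rep: daha_algebra scalar "E0 (t0, u0, t1, u1)" "E1 (t0, u0, t1, u1)" EZ t0 u0 t1 u1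
  for t0 u0 t1 u1
proof
  fix a b :: complex and X :: endo
  show "scalar (a + b) = scalar a + scalar b" by transfer (simp add: fun_eq_iff smult_add_left)
  show "scalar (a * b) = scalar a * scalar b" by transfer (simp add: fun_eq_iff)
  show "scalar 1 = 1" by transfer (simp add: fun_eq_iff)
  show "scalar a * X = X * scalar a" by transfer (simp add: fun_eq_iff)
next
  show "E0 (t0, u0, t1, u1) * E0 (t0, u0, t1, u1) = scalar (t0\<^sup>2)"
  proof (rule endo_eqI)
    fix f x assume "Im x > 0"
    then have "x \<noteq> 1/2" "1 - x \<noteq> 1/2" "1 - 2 * x \<noteq> 0" by (auto simp: complex_eq_iff)
    moreover from this have "1 - 2 * (1 - x) \<noteq> 0" by (simp add: algebra_simps)
    ultimately show "poly (app (E0 (t0, u0, t1, u1) * E0 (t0, u0, t1, u1)) f) x = poly (app (scalar (t0\<^sup>2)) f) x"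
      by (simp add: poly_T0 del: T0.simps) (simp add: divide_simps, algebra)
  qed
  show "E1 (t0, u0, t1, u1) * E1 (t0, u0, t1, u1) = scalar (t1\<^sup>2)"
  proof (rule endo_eqI)
    fix f x assume "Im x > 0"
    then have "x \<noteq> 0" by auto
    then show "poly (app (E1 (t0, u0, t1, u1) * E1 (t0, u0, t1, u1)) f) x = poly (app (scalar (t1\<^sup>2)) f) x"
      by (simp add: poly_T1 del: T1.simps) (simp add: divide_simps, algebra)
  qed
  show "(E0 (t0, u0, t1, u1) + scalar (1/2) - EZ) * (E0 (t0, u0, t1, u1) + scalar (1/2) - EZ)
      = scalar (u0\<^sup>2)"
  proof (rule endo_eqI)
    fix f x assume "Im x > 0"
    then have "x \<noteq> 1/2" "1 - x \<noteq> 1/2" "1 - 2 * x \<noteq> 0" by (auto simp: complex_eq_iff)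
    moreover from this have "1 - 2 * (1 - x) \<noteq> 0" by (simp add: algebra_simps)
    ultimately show "poly (app ((E0 (t0, u0, t1, u1) + scalar (1/2) - EZ) * (E0 (t0, u0, t1, u1) + scalar (1/2) - EZ)) f) x
      = poly (app (scalar (u0\<^sup>2)) f) x"
      by (simp add: poly_T0 del: T0.simps) (simp add: divide_simps, algebra)
  qed
  show "(E1 (t0, u0, t1, u1) + EZ) * (E1 (t0, u0, t1, u1) + EZ) = scalar (u1\<^sup>2)"
  proof (rule endo_eqI)
    fix f x assume "Im x > 0"
    then have "x \<noteq> 0" by auto
    then show "poly (app ((E1 (t0, u0, t1, u1) + EZ) * (E1 (t0, u0, t1, u1) + EZ)) f) x
      = poly (app (scalar (u1\<^sup>2)) f) x"
      by (simp add: poly_T1 del: T1.simps) (simp add: divide_simps, algebra)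
  qed
qed

section \<open>Linear independence of the normal monomials\<close>

text \<open>The orbit of \<open>x\<close> under \<open>x \<mapsto> - x\<close> and \<open>x \<mapsto> 1 - x\<close> is enumerated by the integers so that
  each of the two reflections moves every point to a neighbour; see \<open>orbit_flip\<close>.\<close>

definition orbit :: "complex \<Rightarrow> int \<Rightarrow> complex" where
  "orbit x j = (if even j then x + of_int (j div 2) else - x - of_int (j div 2))"

definition flip :: "bool \<Rightarrow> int \<Rightarrow> int" where
  "flip b j = (if b = even j then j + 1 else j - 1)"

text \<open>The leftmost letter moves first: it is the outermost operator and evaluates the rest of
  the word at the neighbouring point.\<close>

fun target :: "bool list \<Rightarrow> int \<Rightarrow> int" where
  "target [] j = j"
| "target (b # w) j = target w (flip b j)"

lemma orbit_0: "orbit x 0 = x"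
  by (simp add: orbit_def)

lemma orbit_flip: "orbit x (flip b j) = (if b then - orbit x j else 1 - orbit x j)"
proof -
  have "(2 * k - 1) div 2 = k - 1" for k :: int by presburger
  then show ?thesis
    by (cases b; cases "even j") (auto simp: orbit_def flip_def elim!: evenE oddE)
qed

lemma abs_Im_orbit: "\<bar>Im (orbit x j)\<bar> = \<bar>Im x\<bar>"
  by (simp add: orbit_def)

text \<open>Even indices give points in the upper half-plane, odd ones in the lower; within each
  half, distinct indices give distinct integer translates.\<close>

lemma orbit_inject:
  assumes "Im x > 0"
  shows "orbit x j = orbit x k \<longleftrightarrow> j = k"
proof
  assume eq: "orbit x j = orbit x k"
  then have "even j = even k" using assms by (auto simp: orbit_def complex_eq_iff split: if_splits)
  moreover from this eq have "j div 2 = k div 2"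
    by (auto simp: orbit_def split: if_splits)
  ultimately show "j = k" by presburger
qed simp

lemma target_bound: "\<bar>target w j - j\<bar> \<le> int (length w)"
proof (induction w arbitrary: j)
  case (Cons b w)
  from this[of "flip b j"] show ?case by (auto simp: flip_def)
qed simp

text \<open>\<open>flip\<close> changes the parity of the index, so a change of letter continues in
  the same direction: an alternating word walks straight away from \<open>j\<close>.\<close>

lemma target_reduced:
  assumes "distinct_adj (b # w)"
  shows "target (b # w) j =
    (if b = even j then j + int (length (b # w)) else j - int (length (b # w)))"
  using assms
proof (induction w arbitrary: b j)
  case Nil
  show ?case by (simp add: flip_def)
next
  case (Cons a w)
  from Cons.prems have "distinct_adj (a # w)" "b \<noteq> a" by auto
  with Cons.IH[of a "flip b j"] show ?case
    by (auto simp: flip_def)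
qed

lemma abs_target_reduced:
  assumes "distinct_adj w"
  shows "\<bar>target w 0\<bar> = int (length w)"
proof (cases w)
  case (Cons b v)
  then show ?thesis using assms target_reduced[of b v 0] by (simp split: if_splits)
qed simp

text \<open>The side of \<open>j\<close> on which the target lies determines the first letter; the
  rest follows by induction.\<close>

lemma target_inject:
  assumes "distinct_adj v" "distinct_adj w" "length v = length w" "target v j = target w j"
  shows "v = w"
  using assms(3,1,2,4)
proof (induction v w arbitrary: j rule: list_induct2)
  case (Cons a v b w)
  have "a = b"
    using Cons.hyps Cons.prems(3) target_reduced[OF Cons.prems(1), of j] target_reduced[OF Cons.prems(2), of j]
    by (auto split: if_splits)
  moreover have "distinct_adj v" "distinct_adj w"
    using Cons.prems by (auto simp: distinct_adj_Cons)
  ultimately show ?case using Cons.IH[of "flip b j"] Cons.prems(3) by simp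
qed simp

section \<open>Values of the operators along an orbit\<close>

context
  fixes t0 u0 t1 u1 :: complex and M :: real
  defines "M \<equiv> \<bar>Im (t1 + u1)\<bar> + \<bar>Im (t1 - u1)\<bar> + \<bar>Im (t0 + u0)\<bar> + \<bar>Im (t0 - u0)\<bar>"
begin

text \<open>The absolute value of the imaginary part is constant along the orbit. Above
  \<open>M\<close> it keeps all orbit points away from the poles and the zeros of the coefficient
  \<open>\<beta>\<close> of the reflected value.\<close>

lemma generator_on_orbit:
  assumes "Im x > M"
  shows "\<exists>\<alpha> \<beta>. \<beta> \<noteq> 0 \<and> (\<forall>f. poly (app (if b then E1 (t0, u0, t1, u1) else E0 (t0, u0, t1, u1)) f) (orbit x j)
    = \<alpha> * poly f (orbit x j) + \<beta> * poly f (orbit x (flip b j)))"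
proof -
  define y where "y = orbit x j"
  have Im: "\<bar>Im y\<bar> > M" using assms abs_Im_orbit[of x j] by (simp add: y_def)
  have "\<bar>Im y\<bar> > 0" using Im by (simp add: M_def)
  then have y: "y \<noteq> 0" "y \<noteq> 1/2" "1 - 2 * y \<noteq> 0" by (auto simp: complex_eq_iff)
  show ?thesis
  proof (cases b)
    case True
    define \<beta> where "\<beta> = (t1 + u1 + y) * (t1 - u1 + y) / (2 * y)"
    have "t1 + u1 + y \<noteq> 0" "t1 - u1 + y \<noteq> 0"
      using Im unfolding M_def by (auto simp: complex_eq_iff)
    then have "\<beta> \<noteq> 0" using y by (simp add: \<beta>_def)
    moreover have "poly (T1 (t0, u0, t1, u1) f) y = (t1 - \<beta>) * poly f y + \<beta> * poly f (- y)" for f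
      unfolding poly_T1[OF y(1)] \<beta>_def[symmetric] by (simp add: algebra_simps)
    ultimately show ?thesis using True
      by (auto simp: orbit_flip y_def[symmetric] simp del: T1.simps)
  next
    case False
    define \<beta> where "\<beta> = (t0 + u0 + 1/2 - y) * (t0 - u0 + 1/2 - y) / (1 - 2 * y)"
    have "t0 + u0 + 1/2 - y \<noteq> 0" "t0 - u0 + 1/2 - y \<noteq> 0"
      using Im unfolding M_def by (auto simp: complex_eq_iff)
    then have "\<beta> \<noteq> 0" using y by (simp add: \<beta>_def)
    moreover have "poly (T0 (t0, u0, t1, u1) f) y = (t0 - \<beta>) * poly f y + \<beta> * poly f (1 - y)" for f
      unfolding poly_T0[OF y(2)] \<beta>_def[symmetric] by (simp add: algebra_simps)
    ultimately show ?thesis using False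
      by (auto simp: orbit_flip y_def[symmetric] simp del: T0.simps)
  qed
qed

text \<open>Only the product of all reflections in \<open>w\<close> reaches the point \<^term>\<open>target w j\<close>; its
  coefficient there is a product of nonvanishing \<open>\<beta>\<close>'s.\<close>

lemma word_on_orbit:
  assumes "Im x > M"
    and "\<And>k. \<bar>k - j\<bar> < int (length w) \<Longrightarrow> poly f (orbit x k) = 0"
  shows "poly (app (rep.word t0 u0 t1 u1 w) f) (orbit x j) = 0 \<longleftrightarrow> poly f (orbit x (target w j)) = 0"
  using assms(2)
proof (induction w arbitrary: j)
  case (Cons b w)
  define g where "g = app (rep.word t0 u0 t1 u1 w) f"
  obtain \<alpha> \<beta> where "\<beta> \<noteq> 0" and gen: "\<And>f. poly (app (if b then E1 (t0, u0, t1, u1) else E0 (t0, u0, t1, u1)) f) (orbit x j)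
    = \<alpha> * poly f (orbit x j) + \<beta> * poly f (orbit x (flip b j))"
    using generator_on_orbit[OF assms(1), of b j] by blast
  \<comment> \<open>The shorter word moves at most \<open>length w\<close> steps and so stays where
    \<open>f\<close> vanishes; only the reflected term survives.\<close>
  have "poly f (orbit x (target w j)) = 0"
    using target_bound[of w j] by (intro Cons.prems) simp
  then have "poly g (orbit x j) = 0"
    using Cons.IH[of j] Cons.prems by (simp add: g_def)
  moreover have "app (rep.word t0 u0 t1 u1 (b # w)) f = app (if b then E1 (t0, u0, t1, u1) else E0 (t0, u0, t1, u1)) g"
    by (simp add: g_def)
  ultimately have "poly (app (rep.word t0 u0 t1 u1 (b # w)) f) (orbit x j) = \<beta> * poly g (orbit x (flip b j))"
    by (simp add: gen)
  moreover have "poly g (orbit x (flip b j)) = 0 \<longleftrightarrow> poly f (orbit x (target w (flip b j))) = 0"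
    unfolding g_def by (intro Cons.IH Cons.prems) (auto simp: flip_def split: if_splits)
  ultimately show ?case using \<open>\<beta> \<noteq> 0\<close> by simp
qed simp

text \<open>Take a longest word \<open>w\<close> with a nonzero coefficient. For each
  \<open>x\<close> a test polynomial \<open>f\<close> isolates \<open>w\<close>, while the
  coefficients of the monomials with word \<open>w\<close> form a polynomial \<open>q\<close>
  independent of \<open>x\<close>, which must vanish on a half-plane.\<close>

lemma monomials_independent:
  assumes F: "finite F" "\<And>k. k \<in> F \<Longrightarrow> distinct_adj (snd k)"
    and sum0: "(\<Sum>k\<in>F. scalar (c k) * rep.monomial t0 u0 t1 u1 k) = 0"
  shows "\<forall>k\<in>F. c k = 0"
proof (rule ccontr)
  define G where "G = {k \<in> F. c k \<noteq> 0}"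
  assume "\<not> ?thesis"
  then have "G \<noteq> {}" by (auto simp: G_def)
  have "finite G" using F by (simp add: G_def)
  define n where "n = Max ((length \<circ> snd) ` G)"
  have "n \<in> (length \<circ> snd) ` G"
    unfolding n_def using \<open>G \<noteq> {}\<close> \<open>finite G\<close> by (intro Max_in) auto
  then obtain i0 w where iw: "(i0, w) \<in> G" and n: "n = length w" by auto
  have max: "length v \<le> length w" if "(i, v) \<in> G" for i v
  proof -
    have "(length \<circ> snd) (i, v) \<le> n"
      unfolding n_def using that \<open>finite G\<close> by (intro Max_ge imageI) auto
    then show ?thesis using n by simp
  qed
  have w: "distinct_adj w" using iw F(2)[of "(i0, w)"] by (simp add: G_def)
  have v: "distinct_adj v" if "(i, v) \<in> G" for i v
    using that F(2)[of "(i, v)"] by (simp add: G_def)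
  define I where "I = {i. (i, w) \<in> G}"
  have "finite I"
    using finite_vimageI[OF \<open>finite G\<close>, of "\<lambda>i. (i, w)"] by (simp add: I_def vimage_def inj_def)
  define q where "q = (\<Sum>i\<in>I. monom (c (i, w)) i)"
  have "q = 0"
  proof (rule poly_eq_zero_Im_greater)
    fix x assume x: "Im x > M"
    then have "Im x > 0" by (simp add: M_def)
    \<comment> \<open>Words of length at most \<open>n\<close> lead from index 0 into this interval;
      on it, \<open>f\<close> is nonzero only at the target of \<open>w\<close>.\<close>
    define K where "K = {- int n..int n} - {target w 0}"
    define f where "f = (\<Prod>k\<in>K. [:- orbit x k, 1:])"
    have f: "poly f (orbit x j) = 0 \<longleftrightarrow> j \<in> K" for j
    proof -
      have "finite K" by (simp add: K_def)
      then show ?thesis by (auto simp: f_def poly_prod orbit_inject[OF \<open>Im x > 0\<close>])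
    qed
    have zero: "poly (app (rep.word t0 u0 t1 u1 v) f) x = 0 \<longleftrightarrow> v \<noteq> w" if "(i, v) \<in> G" for i v
    proof -
      \<comment> \<open>The target of \<open>w\<close> has distance exactly \<open>n\<close> from 0,
        so the strict bound excludes it.\<close>
      have "poly f (orbit x k) = 0" if "\<bar>k - 0\<bar> < int (length v)" for k
        using that max[OF \<open>(i, v) \<in> G\<close>] abs_target_reduced[OF w] by (auto simp: f K_def n)
      from word_on_orbit[of x 0 v f, OF x this]
      have "poly (app (rep.word t0 u0 t1 u1 v) f) x = 0 \<longleftrightarrow> target v 0 \<in> K"
        by (simp add: f orbit_0)
      also have "\<dots> \<longleftrightarrow> target v 0 \<noteq> target w 0"
        using max[OF that] target_bound[of v 0] by (auto simp: K_def n)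
      \<comment> \<open>The distance of the target from 0 recovers the length of an alternating
        word, as \<open>target_inject\<close> requires.\<close>
      also have "\<dots> \<longleftrightarrow> v \<noteq> w"
      proof -
        have "length v = length w" if "target v 0 = target w 0"
          using that abs_target_reduced[OF w] abs_target_reduced[OF v[OF \<open>(i, v) \<in> G\<close>]] by simp
        then show ?thesis using target_inject[OF v[OF that] w] by blast
      qed
      finally show ?thesis .
    qed
    define y where "y = poly (app (rep.word t0 u0 t1 u1 w) f) x"
    have power: "poly (app (EZ ^ i) g) x = x ^ i * poly g x" for i g
      by (induction i) simp_all
    have "0 = poly (app (\<Sum>k\<in>F. scalar (c k) * rep.monomial t0 u0 t1 u1 k) f) x"
      by (simp add: sum0)
    also have "\<dots> = (\<Sum>k\<in>F. c k * x ^ fst k * poly (app (rep.word t0 u0 t1 u1 (snd k)) f) x)"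
      by (simp add: app_sum poly_sum rep.monomial_def power mult.assoc)
    also have "\<dots> = (\<Sum>k\<in>(\<lambda>i. (i, w)) ` I. c k * x ^ fst k * y)"
      using F(1) zero by (intro sum.mono_neutral_cong_right) (auto simp: I_def G_def y_def)
    also have "\<dots> = poly q x * y"
      by (subst sum.reindex) (auto simp: inj_on_def q_def poly_sum poly_monom sum_distrib_right)
    finally show "poly q x = 0" using zero[OF iw] by (simp add: y_def)
  qed
  moreover have "coeff q i0 = c (i0, w)"
    using iw \<open>finite I\<close> by (simp add: q_def coeff_sum I_def)
  ultimately show False using iw by (simp add: G_def)
qed

end


section \<open>The presentation of the algebra\<close>

text \<open>The elements \<open>\<tau>0\<close>, \<open>\<tau>1\<close>,
  \<open>- (\<tau>1 + \<zeta>)\<close> and \<open>- (\<tau>0 + C (1/2) - \<zeta>)\<close> have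
  scalar squares and sum to \<open>- C (1/2)\<close>. The duality exchanges the first and the
  third.\<close>

lemma (in daha_algebra) daha_algebra_dual:
  "daha_algebra C (- (\<tau>1 + \<zeta>)) \<tau>1 (- (\<tau>0 + \<tau>1)) u1 u0 t1 t0"
proof
  show "- (\<tau>1 + \<zeta>) * - (\<tau>1 + \<zeta>) = C (u1\<^sup>2)"
    by (simp only: minus_mult_minus \<tau>1_\<zeta>_square)
  have "- (\<tau>1 + \<zeta>) + C (1/2) - - (\<tau>0 + \<tau>1) = \<tau>0 + C (1/2) - \<zeta>" by simp
  then show "(- (\<tau>1 + \<zeta>) + C (1/2) - - (\<tau>0 + \<tau>1)) * (- (\<tau>1 + \<zeta>) + C (1/2) - - (\<tau>0 + \<tau>1)) = C (u0\<^sup>2)"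
    by (simp only: \<tau>0_\<zeta>_square)
  have "\<tau>1 + - (\<tau>0 + \<tau>1) = - \<tau>0" by simp
  then show "(\<tau>1 + - (\<tau>0 + \<tau>1)) * (\<tau>1 + - (\<tau>0 + \<tau>1)) = C (t0\<^sup>2)"
    by (simp only: minus_mult_minus \<tau>0_square)
qed (fact C_add C_mult C_one C_commute \<tau>1_square)+

lemma daha_algebra_Pair:
  assumes "daha_algebra C \<tau>0 \<tau>1 \<zeta> t0 u0 t1 u1" "daha_algebra D \<upsilon>0 \<upsilon>1 \<xi> t0 u0 t1 u1"
  shows "daha_algebra (\<lambda>c. (C c, D c)) (\<tau>0, \<upsilon>0) (\<tau>1, \<upsilon>1) (\<zeta>, \<xi>) t0 u0 t1 u1"
proof -
  interpret A: daha_algebra C \<tau>0 \<tau>1 \<zeta> t0 u0 t1 u1 by fact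
  interpret B: daha_algebra D \<upsilon>0 \<upsilon>1 \<xi> t0 u0 t1 u1 by fact
  show ?thesis
  proof
    show "(C a, D a) * x = x * (C a, D a)" for a x
      by (simp add: prod_eq_iff A.C_commute[of a "fst x"] B.C_commute[of a "snd x"])
  qed (simp_all only: prod_eq_iff fst_conv snd_conv fst_add snd_add fst_diff snd_diff fst_times snd_times
      fst_one snd_one A.C_add A.C_mult A.C_one A.\<tau>0_square A.\<tau>1_square A.\<tau>0_\<zeta>_square A.\<tau>1_\<zeta>_square
      B.C_add B.C_mult B.C_one B.\<tau>0_square B.\<tau>1_square B.\<tau>0_\<zeta>_square B.\<tau>1_\<zeta>_square)
qed

lemma (in daha_algebra) daha_algebra_op:
  "daha_algebra (\<lambda>c. op (C c)) (op \<tau>0) (op \<tau>1) (op \<zeta>) t0 u0 t1 u1"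
proof
  show "op (C (a + b)) = op (C a) + op (C b)" for a b
    by (simp add: C_add plus_opposite.abs_eq)
  show "op (C (a * b)) = op (C a) * op (C b)" for a b
    by (simp add: C_mult[of b a] mult.commute[of a b] times_opposite.abs_eq)
  show "op (C 1) = 1"
    by (simp add: C_one one_opposite_def)
  show "op (C a) * x = x * op (C a)" for a x
    by (cases x) (simp add: times_opposite.abs_eq C_commute[of a])
qed (simp_all only: times_opposite.abs_eq plus_opposite.abs_eq minus_opposite.abs_eq
    \<tau>0_square \<tau>1_square \<tau>0_\<zeta>_square \<tau>1_\<zeta>_square)

text \<open>The algebra generated by the pairs of generators is the graph of \<open>\<Phi>\<close>.
  It projects onto \<open>rep.algebra\<close>, and injectively: in normal form both components share
  the coefficients \<open>c k\<close>, which vanish by independence when the first component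
  does.\<close>

lemma presentation:
  assumes "daha_algebra D \<upsilon>0 \<upsilon>1 \<xi> t0 u0 t1 u1"
  obtains \<Phi> where "\<Phi> (E0 (t0, u0, t1, u1)) = \<upsilon>0" "\<Phi> (E1 (t0, u0, t1, u1)) = \<upsilon>1" "\<Phi> EZ = \<xi>"
    "\<And>c. \<Phi> (scalar c) = D c"
    "\<And>X Y. X \<in> rep.algebra t0 u0 t1 u1 \<Longrightarrow> Y \<in> rep.algebra t0 u0 t1 u1 \<Longrightarrow> \<Phi> (X + Y) = \<Phi> X + \<Phi> Y"
    "\<And>X Y. X \<in> rep.algebra t0 u0 t1 u1 \<Longrightarrow> Y \<in> rep.algebra t0 u0 t1 u1 \<Longrightarrow> \<Phi> (X * Y) = \<Phi> X * \<Phi> Y"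
proof -
  interpret P: daha_algebra "\<lambda>c. (scalar c, D c)" "(E0 (t0, u0, t1, u1), \<upsilon>0)"
    "(E1 (t0, u0, t1, u1), \<upsilon>1)" "(EZ, \<xi>)" t0 u0 t1 u1
    using rep.daha_algebra_axioms assms by (rule daha_algebra_Pair)
  have word: "fst (P.word w) = rep.word t0 u0 t1 u1 w" for w
    by (induction w) simp_all
  have zero: "x = 0" if x: "x \<in> P.algebra" "fst x = 0" for x
  proof -
    obtain F c where F: "finite F" "\<forall>k\<in>F. distinct_adj (snd k)"
      and sum: "x = (\<Sum>k\<in>F. (scalar (c k), D (c k)) * P.monomial k)"
      using P.normal_sum x(1) P.algebra_subset_normal by blast
    have "(\<Sum>k\<in>F. scalar (c k) * rep.monomial t0 u0 t1 u1 k) = 0"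
      using x(2) by (simp add: sum fst_sum P.monomial_def rep.monomial_def word)
    then have "\<forall>k\<in>F. c k = 0" using monomials_independent F by blast
    then show ?thesis by (simp add: sum P.C_zero)
  qed
  have unique: "x = y" if "x \<in> P.algebra" "y \<in> P.algebra" "fst x = fst y" for x y
  proof -
    have "x + (scalar (- 1), D (- 1)) * y = x - y"
      by (simp only: P.C_uminus P.C_one) simp
    moreover have "x + (scalar (- 1), D (- 1)) * y \<in> P.algebra"
      by (intro P.algebra.intros that)
    ultimately show ?thesis using zero[of "x - y"] that(3) by simp
  qed
  have exists: "\<exists>x\<in>P.algebra. fst x = X" if "X \<in> rep.algebra t0 u0 t1 u1" for X
    using that
  proof induction
    case \<tau>0
    then show ?case using P.algebra.\<tau>0 by force
  next
    case \<tau>1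
    then show ?case using P.algebra.\<tau>1 by force
  next
    case \<zeta>
    then show ?case using P.algebra.\<zeta> by force
  next
    case (scalar c)
    then show ?case using P.algebra.scalar[of c] by force
  next
    case (add X Y)
    then obtain x y where xy: "x \<in> P.algebra" "fst x = X" "y \<in> P.algebra" "fst y = Y" by blast
    show ?case
      by (rule bexI[of _ "x + y"]) (simp_all add: xy P.algebra.add)
  next
    case (mult X Y)
    then obtain x y where xy: "x \<in> P.algebra" "fst x = X" "y \<in> P.algebra" "fst y = Y" by blast
    show ?case
      by (rule bexI[of _ "x * y"]) (simp_all add: xy P.algebra.mult)
  qed
  \<comment> \<open>Existence and uniqueness determine this value on \<open>rep.algebra\<close>;
    elsewhere it is unspecified.\<close>
  define \<Phi> where "\<Phi> X = snd (THE x. x \<in> P.algebra \<and> fst x = X)" for X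
  have \<Phi>: "\<Phi> (fst x) = snd x" if "x \<in> P.algebra" for x
  proof -
    have "(THE y. y \<in> P.algebra \<and> fst y = fst x) = x"
      using that unique by (intro the_equality) auto
    then show ?thesis by (simp add: \<Phi>_def)
  qed
  show thesis
  proof
    fix X Y assume X: "X \<in> rep.algebra t0 u0 t1 u1" and Y: "Y \<in> rep.algebra t0 u0 t1 u1"
    obtain x where x: "x \<in> P.algebra" "fst x = X" using exists[OF X] by blast
    obtain y where y: "y \<in> P.algebra" "fst y = Y" using exists[OF Y] by blast
    show "\<Phi> (X + Y) = \<Phi> X + \<Phi> Y"
      using \<Phi>[OF P.algebra.add[OF x(1) y(1)]] \<Phi>[OF x(1)] \<Phi>[OF y(1)] x(2) y(2) by simp
    show "\<Phi> (X * Y) = \<Phi> X * \<Phi> Y"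
      using \<Phi>[OF P.algebra.mult[OF x(1) y(1)]] \<Phi>[OF x(1)] \<Phi>[OF y(1)] x(2) y(2) by simp
  qed (use \<Phi>[OF P.algebra.\<tau>0] \<Phi>[OF P.algebra.\<tau>1] \<Phi>[OF P.algebra.\<zeta>] \<Phi>[OF P.algebra.scalar] in simp_all)
qed

text \<open>\<open>endo\<close> inverts \<open>app\<close> only on linear maps. Induction exhibits
  each \<open>X\<close> as \<open>app E\<close> with \<open>E\<close> in \<open>rep.algebra\<close>,
  where \<open>id\<close> becomes \<open>scalar 1\<close> and scaling becomes multiplication by a
  scalar.\<close>

lemma H_algebra:
  assumes "X \<in> H (t0, u0, t1, u1)"
  shows "app (endo X) = X" and "endo X \<in> rep.algebra t0 u0 t1 u1"
proof -
  have "\<exists>E\<in>rep.algebra t0 u0 t1 u1. app E = X"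
    using assms unfolding H_def
  proof induction
    case (gen X)
    then consider "X = T0 (t0, u0, t1, u1)" | "X = T1 (t0, u0, t1, u1)" | "X = Z" by blast
    then show ?case
      by cases
        (use app_E0 app_E1 app_EZ in \<open>blast intro: rep.algebra.\<tau>0 rep.algebra.\<tau>1 rep.algebra.\<zeta>\<close>)+
  next
    case one
    have "app (scalar 1) = id" by (rule ext) (simp only: app_algebra smult_1_left id_apply)
    then show ?case using rep.algebra.scalar by (rule rev_bexI[rotated])
  next
    case (add X Y)
    then obtain D E where DE: "D \<in> rep.algebra t0 u0 t1 u1" "app D = X"
      "E \<in> rep.algebra t0 u0 t1 u1" "app E = Y" by (elim bexE)
    show ?case
      by (rule bexI[OF _ rep.algebra.add[OF DE(1,3)]]) (simp only: plus_endo.rep_eq DE)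
  next
    case (scale X c)
    then obtain E where E: "E \<in> rep.algebra t0 u0 t1 u1" "app E = X" by (elim bexE)
    show ?case
      by (rule bexI[OF _ rep.algebra.mult[OF rep.algebra.scalar E(1)]], rule ext)
        (simp only: app_algebra E)
  next
    case (mult X Y)
    then obtain D E where DE: "D \<in> rep.algebra t0 u0 t1 u1" "app D = X"
      "E \<in> rep.algebra t0 u0 t1 u1" "app E = Y" by (elim bexE)
    show ?case
      by (rule bexI[OF _ rep.algebra.mult[OF DE(1,3)]]) (simp only: times_endo.rep_eq DE)
  qed
  then show "app (endo X) = X" "endo X \<in> rep.algebra t0 u0 t1 u1"
    by (auto simp: app_inverse)
qed

section \<open>The duality maps\<close>

text \<open>Taking \<open>m = (\<circ>)\<close> gives the homomorphisms and \<open>m = (\<lambda>X Y. Y \<circ> X)\<close> the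
  antihomomorphisms.\<close>

definition mult_hom ::
  "(operator \<Rightarrow> operator \<Rightarrow> operator) \<Rightarrow> operator set \<Rightarrow> operator set \<Rightarrow> (operator \<Rightarrow> operator) \<Rightarrow> bool" where
  "mult_hom m A B \<phi> \<longleftrightarrow> algebra_linear A B \<phi> \<and> (\<forall>X\<in>A. \<forall>Y\<in>A. \<phi> (X \<circ> Y) = m (\<phi> X) (\<phi> Y))"

lemma H_intros:
  shows H_T0: "T0 t \<in> H t"
    and H_T1: "T1 t \<in> H t"
    and H_Z: "Z \<in> H t"
    and H_id: "id \<in> H t"
    and H_add: "X \<in> H t \<Longrightarrow> Y \<in> H t \<Longrightarrow> (\<lambda>f. X f + Y f) \<in> H t"
    and H_scale: "X \<in> H t \<Longrightarrow> (\<lambda>f. smult c (X f)) \<in> H t"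
    and H_comp: "X \<in> H t \<Longrightarrow> Y \<in> H t \<Longrightarrow> X \<circ> Y \<in> H t"
  unfolding H_def by (simp_all add: subalgebra_generated.intros)

lemma H_minus_add:
  assumes "X \<in> H t" "Y \<in> H t"
  shows "(\<lambda>f. - (X f + Y f)) \<in> H t"
  using H_scale[OF H_add[OF assms], of "- 1"] by simp

lemma H_induct [consumes 1, case_names T0 T1 Z id add scale comp]:
  assumes "X \<in> H t" "P (T0 t)" "P (T1 t)" "P Z" "P id"
    and "\<And>X Y. X \<in> H t \<Longrightarrow> P X \<Longrightarrow> Y \<in> H t \<Longrightarrow> P Y \<Longrightarrow> P (\<lambda>f. X f + Y f)"
    and "\<And>X c. X \<in> H t \<Longrightarrow> P X \<Longrightarrow> P (\<lambda>f. smult c (X f))"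
    and "\<And>X Y. X \<in> H t \<Longrightarrow> P X \<Longrightarrow> Y \<in> H t \<Longrightarrow> P Y \<Longrightarrow> P (X \<circ> Y)"
  shows "P X"
  using assms(1)[unfolded H_def]
  by induction (use assms(2-) in \<open>auto simp: H_def simp del: id_apply o_apply\<close>)

text \<open>\<open>\<iota>\<close> reads elements of the target ring as operators and turns its
  product into \<open>m\<close>; it is used for the ring of endomorphisms and for its opposite. The
  extension is the composite of \<open>endo\<close>, \<open>\<Phi>\<close> and
  \<open>\<iota>\<close>.\<close>

lemma duality_extension_exists:
  fixes \<iota> :: "'b::ring_1 \<Rightarrow> operator"
  assumes D: "daha_algebra D \<upsilon>0 \<upsilon>1 \<xi> t0 u0 t1 u1"
    and \<upsilon>0: "\<iota> \<upsilon>0 = (\<lambda>f. - (T1 (dual (t0, u0, t1, u1)) f + Z f))"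
    and \<upsilon>1: "\<iota> \<upsilon>1 = T1 (dual (t0, u0, t1, u1))"
    and \<xi>: "\<iota> \<xi> = (\<lambda>f. - (T0 (dual (t0, u0, t1, u1)) f + T1 (dual (t0, u0, t1, u1)) f))"
    and one: "\<iota> 1 = id"
    and add: "\<And>x y. \<iota> (x + y) = (\<lambda>f. \<iota> x f + \<iota> y f)"
    and scale: "\<And>c x. \<iota> (D c * x) = (\<lambda>f. smult c (\<iota> x f))"
    and mult: "\<And>x y. \<iota> (x * y) = m (\<iota> x) (\<iota> y)"
    and m: "\<And>t X Y. X \<in> H t \<Longrightarrow> Y \<in> H t \<Longrightarrow> m X Y \<in> H t"
  shows "\<exists>\<phi>. mult_hom m (H (t0, u0, t1, u1)) (H (dual (t0, u0, t1, u1))) \<phi> \<and>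
    duality_values (t0, u0, t1, u1) \<phi>"
proof -
  define t where "t = (t0, u0, t1, u1)"
  obtain \<Phi> where \<Phi>: "\<Phi> (E0 t) = \<upsilon>0" "\<Phi> (E1 t) = \<upsilon>1" "\<Phi> EZ = \<xi>" "\<And>c. \<Phi> (scalar c) = D c"
    and \<Phi>_add: "\<And>X Y. X \<in> rep.algebra t0 u0 t1 u1 \<Longrightarrow> Y \<in> rep.algebra t0 u0 t1 u1 \<Longrightarrow> \<Phi> (X + Y) = \<Phi> X + \<Phi> Y"
    and \<Phi>_mult: "\<And>X Y. X \<in> rep.algebra t0 u0 t1 u1 \<Longrightarrow> Y \<in> rep.algebra t0 u0 t1 u1 \<Longrightarrow> \<Phi> (X * Y) = \<Phi> X * \<Phi> Y"
    unfolding t_def using presentation[OF D] by blast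
  define \<phi> where "\<phi> X = \<iota> (\<Phi> (endo X))" for X
  have H: "app (endo X) = X" "endo X \<in> rep.algebra t0 u0 t1 u1" if "X \<in> H t" for X
    using H_algebra that by (simp_all add: t_def)
  \<comment> \<open>\<open>id\<close> is written as \<open>scalar 1\<close> because
    \<open>\<Phi>\<close> is known on scalars.\<close>
  have gens: "endo (T0 t) = E0 t" "endo (T1 t) = E1 t" "endo Z = EZ" "endo id = scalar 1"
    by (simp_all add: app_inverse[of "E0 t", simplified] app_inverse[of "E1 t", simplified]
        app_inverse[of EZ, simplified] rep.C_one one_endo_def)
  have vals: "duality_values t \<phi>"
    by (simp add: duality_values_def \<phi>_def gens \<Phi> \<upsilon>0[folded t_def] \<upsilon>1[folded t_def] \<xi>[folded t_def])
  have \<phi>_id: "\<phi> id = id"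
    using daha_algebra.C_one[OF D] by (simp add: \<phi>_def gens \<Phi> one)
  have \<phi>_add: "\<phi> (\<lambda>f. X f + Y f) = (\<lambda>f. \<phi> X f + \<phi> Y f)" if "X \<in> H t" "Y \<in> H t" for X Y
  proof -
    have "app (endo X + endo Y) = (\<lambda>f. X f + Y f)"
      by (simp only: plus_endo.rep_eq H(1) that)
    then have "endo (\<lambda>f. X f + Y f) = endo X + endo Y"
      using app_inverse[of "endo X + endo Y"] by simp
    then show ?thesis using H(2) that by (simp add: \<phi>_def \<Phi>_add add)
  qed
  have \<phi>_scale: "\<phi> (\<lambda>f. smult c (X f)) = (\<lambda>f. smult c (\<phi> X f))" if "X \<in> H t" for X c
  proof -
    have "app (scalar c * endo X) = (\<lambda>f. smult c (X f))"
      using H(1)[OF that] by (simp add: fun_eq_iff)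
    then have "endo (\<lambda>f. smult c (X f)) = scalar c * endo X"
      using app_inverse[of "scalar c * endo X"] by simp
    then show ?thesis using H(2)[OF that]
      by (simp add: \<phi>_def \<Phi>_mult rep.algebra.scalar \<Phi> scale)
  qed
  have \<phi>_mult: "\<phi> (X \<circ> Y) = m (\<phi> X) (\<phi> Y)" if "X \<in> H t" "Y \<in> H t" for X Y
  proof -
    have "app (endo X * endo Y) = X \<circ> Y"
      by (simp only: times_endo.rep_eq H(1) that)
    then have "endo (X \<circ> Y) = endo X * endo Y"
      using app_inverse[of "endo X * endo Y"] by simp
    then show ?thesis using H(2) that by (simp add: \<phi>_def \<Phi>_mult mult)
  qed
  have "\<phi> X \<in> H (dual t)" if "X \<in> H t" for X
    using that
  proof (induction rule: H_induct)
    case (comp X Y)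
    then show ?case by (simp only: \<phi>_mult m)
  qed (use vals in \<open>simp_all only: duality_values_def \<phi>_id \<phi>_add \<phi>_scale H_intros H_minus_add\<close>)
  then show ?thesis
    using vals \<phi>_id \<phi>_add \<phi>_scale \<phi>_mult
    unfolding mult_hom_def algebra_linear_def t_def[symmetric] by (intro exI[of _ \<phi>]) auto
qed

text \<open>In the opposite ring a left scalar factor acts on the right, hence the two scalar rules;
  \<open>app_scale_right\<close> rests on the linearity of \<open>app X\<close>.\<close>

lemma app_simps:
  shows app_one: "app 1 = id"
    and app_plus: "app (X + Y) = (\<lambda>f. app X f + app Y f)"
    and app_scale: "app (scalar c) \<circ> app X = (\<lambda>f. smult c (app X f))"
    and app_scale_right: "app X \<circ> app (scalar c) = (\<lambda>f. smult c (app X f))"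
    and app_times: "app (X * Y) = app X \<circ> app Y"
    and app_minus_plus: "app (- (X + Y)) = (\<lambda>f. - (app X f + app Y f))"
  by (rule ext, simp only: app_algebra app_smult id_apply o_apply)+

text \<open>Since \<open>dual\<close> is an involution, \<open>daha_algebra_dual\<close> turns the
  relations of the operators for \<open>dual t\<close> into relations with parameters
  \<open>t\<close>, to which the presentation applies.\<close>

lemma duality_hom_exists: "\<exists>\<phi>. mult_hom (\<circ>) (H t) (H (dual t)) \<phi> \<and> duality_values t \<phi>"
proof -
  obtain t0 u0 t1 u1 where t: "t = (t0, u0, t1, u1)" by (cases t)
  show ?thesis
    unfolding t
  proof (rule duality_extension_exists[where \<iota> = app, OF rep.daha_algebra_dual])
    show "X \<circ> Y \<in> H s" if "X \<in> H s" "Y \<in> H s" for s X Y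
      using that by (rule H_comp)
  qed (simp_all only: dual.simps app_simps app_E0 app_E1 app_EZ)
qed

lemma duality_antihom_exists:
  "\<exists>\<phi>. mult_hom (\<lambda>X Y. Y \<circ> X) (H t) (H (dual t)) \<phi> \<and> duality_values t \<phi>"
proof -
  obtain t0 u0 t1 u1 where t: "t = (t0, u0, t1, u1)" by (cases t)
  show ?thesis
    unfolding t
  proof (rule duality_extension_exists[where \<iota> = "\<lambda>x. app (unop x)",
        OF daha_algebra.daha_algebra_op[OF rep.daha_algebra_dual]])
    show "Y \<circ> X \<in> H s" if "X \<in> H s" "Y \<in> H s" for s X Y
      using that(2,1) by (rule H_comp)
  qed (simp_all only: dual.simps app_simps app_E0 app_E1 app_EZ op_inverse[OF UNIV_I]
      one_opposite.rep_eq plus_opposite.rep_eq times_opposite.rep_eq)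
qed

section \<open>Uniqueness and inverses of the duality maps\<close>

lemma mult_homD:
  assumes "mult_hom m A B \<phi>"
  shows mult_hom_mem: "X \<in> A \<Longrightarrow> \<phi> X \<in> B"
    and mult_hom_id: "\<phi> id = id"
    and mult_hom_add: "X \<in> A \<Longrightarrow> Y \<in> A \<Longrightarrow> \<phi> (\<lambda>f. X f + Y f) = (\<lambda>f. \<phi> X f + \<phi> Y f)"
    and mult_hom_scale: "X \<in> A \<Longrightarrow> \<phi> (\<lambda>f. smult c (X f)) = (\<lambda>f. smult c (\<phi> X f))"
    and mult_hom_mult: "X \<in> A \<Longrightarrow> Y \<in> A \<Longrightarrow> \<phi> (X \<circ> Y) = m (\<phi> X) (\<phi> Y)"
proof -
  note linear = assms[unfolded mult_hom_def algebra_linear_def, THEN conjunct1]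
  show "X \<in> A \<Longrightarrow> \<phi> X \<in> B"
    using linear[THEN conjunct1] by blast
  show "\<phi> id = id"
    by (rule linear[THEN conjunct2, THEN conjunct1])
  show "\<phi> (\<lambda>f. X f + Y f) = (\<lambda>f. \<phi> X f + \<phi> Y f)" if "X \<in> A" "Y \<in> A"
    using linear[THEN conjunct2, THEN conjunct2, THEN conjunct1, rule_format, OF that] .
  show "\<phi> (\<lambda>f. smult c (X f)) = (\<lambda>f. smult c (\<phi> X f))" if "X \<in> A"
    using linear[THEN conjunct2, THEN conjunct2, THEN conjunct2, rule_format, OF that] .
  show "\<phi> (X \<circ> Y) = m (\<phi> X) (\<phi> Y)" if "X \<in> A" "Y \<in> A"
    using assms[unfolded mult_hom_def, THEN conjunct2, rule_format, OF that] .
qed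

lemma mult_hom_eq:
  assumes "mult_hom m (H t) (H (dual t)) \<phi>" "duality_values t \<phi>"
    and "mult_hom m (H t) (H (dual t)) \<phi>'" "duality_values t \<phi>'"
    and "X \<in> H t"
  shows "\<phi>' X = \<phi> X"
  using assms(5)
proof (induction rule: H_induct)
  case (add X Y)
  then show ?case by (simp only: mult_hom_add[OF assms(1)] mult_hom_add[OF assms(3)])
next
  case (scale X c)
  then show ?case by (simp only: mult_hom_scale[OF assms(1)] mult_hom_scale[OF assms(3)])
next
  case (comp X Y)
  then show ?case by (simp only: mult_hom_mult[OF assms(1)] mult_hom_mult[OF assms(3)])
qed (use assms(2,4) in \<open>simp_all only: duality_values_def mult_hom_id[OF assms(1)] mult_hom_id[OF assms(3)]\<close>)

lemma dual_dual [simp]: "dual (dual t) = t"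
  by (cases t) simp

lemma mult_hom_minus_add:
  assumes \<phi>: "mult_hom m (H t) B \<phi>" and XY: "X \<in> H t" "Y \<in> H t"
  shows "\<phi> (\<lambda>f. - (X f + Y f)) = (\<lambda>f. - (\<phi> X f + \<phi> Y f))"
  using mult_hom_scale[OF \<phi> H_add[OF XY], of "- 1"] mult_hom_add[OF \<phi> XY] by simp

text \<open>On generators the composite cancels, for instance
  \<open>- (T1 - (T0 + T1)) = T0\<close>. Two reversals restore the order of products, so the
  composite is multiplicative for both choices of \<open>m\<close>.\<close>

lemma mult_hom_involution:
  assumes m: "m = (\<circ>) \<or> m = (\<lambda>X Y. Y \<circ> X)"
    and \<phi>: "mult_hom m (H t) (H (dual t)) \<phi>" "duality_values t \<phi>"
    and \<chi>: "mult_hom m (H (dual t)) (H t) \<chi>" "duality_values (dual t) \<chi>"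
    and X: "X \<in> H t"
  shows "\<chi> (\<phi> X) = X"
  using X
proof (induction rule: H_induct)
  case T0
  have "\<chi> (\<phi> (T0 t)) = (\<lambda>f. - (\<chi> (T1 (dual t)) f + \<chi> Z f))"
    using \<phi>(2) mult_hom_minus_add[OF \<chi>(1) H_T1 H_Z] by (simp only: duality_values_def)
  also have "\<dots> = T0 t"
    using \<chi>(2) by (simp add: duality_values_def)
  finally show ?case .
next
  case T1
  show ?case using \<phi>(2) \<chi>(2) by (simp only: duality_values_def dual_dual)
next
  case Z
  have "\<chi> (\<phi> Z) = (\<lambda>f. - (\<chi> (T0 (dual t)) f + \<chi> (T1 (dual t)) f))"
    using \<phi>(2) mult_hom_minus_add[OF \<chi>(1) H_T0 H_T1] by (simp only: duality_values_def)
  also have "\<dots> = Z"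
    using \<chi>(2) by (simp add: duality_values_def)
  finally show ?case .
next
  case id
  show ?case by (simp only: mult_hom_id[OF \<phi>(1)] mult_hom_id[OF \<chi>(1)])
next
  case (add X Y)
  then show ?case
    by (simp only: mult_hom_add[OF \<phi>(1)] mult_hom_add[OF \<chi>(1)] mult_hom_mem[OF \<phi>(1)])
next
  case (scale X c)
  then show ?case
    by (simp only: mult_hom_scale[OF \<phi>(1)] mult_hom_scale[OF \<chi>(1)] mult_hom_mem[OF \<phi>(1)])
next
  case (comp X Y)
  have "\<chi> (m (\<phi> X) (\<phi> Y)) = X \<circ> Y"
    using m
  proof
    assume "m = (\<circ>)"
    then show ?thesis using comp
      by (simp only: mult_hom_mult[OF \<chi>(1)] mult_hom_mem[OF \<phi>(1)])
  next
    assume "m = (\<lambda>X Y. Y \<circ> X)"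
    then show ?thesis using comp
      by (simp only: mult_hom_mult[OF \<chi>(1)] mult_hom_mem[OF \<phi>(1)])
  qed
  then show ?case using comp by (simp only: mult_hom_mult[OF \<phi>(1)])
qed

lemma duality:
  assumes m: "m = (\<circ>) \<or> m = (\<lambda>X Y. Y \<circ> X)"
    and \<phi>: "mult_hom m (H t) (H (dual t)) \<phi>" "duality_values t \<phi>"
    and \<chi>: "mult_hom m (H (dual t)) (H t) \<chi>" "duality_values (dual t) \<chi>"
  shows "bij_betw \<phi> (H t) (H (dual t))" and "\<forall>Y\<in>H (dual t). inv_into (H t) \<phi> Y = \<chi> Y"
proof -
  \<comment> \<open>Exchanging the roles of \<open>t\<close> and \<open>dual t\<close> in the
    involution lemma makes \<open>\<chi>\<close> a two-sided inverse.\<close>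
  have \<phi>\<chi>: "\<phi> (\<chi> Y) = Y" if "Y \<in> H (dual t)" for Y
    using mult_hom_involution[OF m, of "dual t" \<chi> \<phi>, unfolded dual_dual, OF \<chi> \<phi> that] .
  show bij: "bij_betw \<phi> (H t) (H (dual t))"
    using mult_hom_involution[OF m \<phi> \<chi>] \<phi>\<chi> mult_hom_mem[OF \<phi>(1)] mult_hom_mem[OF \<chi>(1)]
    by (intro bij_betw_byWitness[where f' = \<chi>]) blast+
  show "\<forall>Y\<in>H (dual t). inv_into (H t) \<phi> Y = \<chi> Y"
  proof
    fix Y assume "Y \<in> H (dual t)"
    then show "inv_into (H t) \<phi> Y = \<chi> Y"
      using inv_into_f_f[OF bij_betw_imp_inj_on[OF bij], of "\<chi> Y"] \<phi>\<chi> mult_hom_mem[OF \<chi>(1)] by simp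
  qed
qed

theorem proposition3p11:
  fixes t :: params
  assumes "generic t"
  shows "(\<exists>\<sigma> \<sigma>_dual.
            unique_hom_extension t \<sigma> \<and> algebra_iso (H t) (H (dual t)) \<sigma> \<and>
            unique_hom_extension (dual t) \<sigma>_dual \<and>
            (\<forall>Y\<in>H (dual t). inv_into (H t) \<sigma> Y = \<sigma>_dual Y))
       \<and> (\<exists>\<psi> \<psi>_dual.
            unique_antihom_extension t \<psi> \<and> algebra_antiiso (H t) (H (dual t)) \<psi> \<and>
            unique_antihom_extension (dual t) \<psi>_dual \<and>
            (\<forall>Y\<in>H (dual t). inv_into (H t) \<psi> Y = \<psi>_dual Y))"
proof
  have alg_hom: "algebra_hom A B = mult_hom (\<circ>) A B" for A B
    by (simp add: fun_eq_iff algebra_hom_def mult_hom_def)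
  obtain \<sigma> where \<sigma>: "mult_hom (\<circ>) (H t) (H (dual t)) \<sigma>" "duality_values t \<sigma>"
    using duality_hom_exists[of t] by (elim exE conjE)
  obtain \<sigma>_dual where \<sigma>_dual:
    "mult_hom (\<circ>) (H (dual t)) (H t) \<sigma>_dual" "duality_values (dual t) \<sigma>_dual"
    using duality_hom_exists[of "dual t", unfolded dual_dual] by (elim exE conjE)
  show "\<exists>\<sigma> \<sigma>_dual.
            unique_hom_extension t \<sigma> \<and> algebra_iso (H t) (H (dual t)) \<sigma> \<and>
            unique_hom_extension (dual t) \<sigma>_dual \<and>
            (\<forall>Y\<in>H (dual t). inv_into (H t) \<sigma> Y = \<sigma>_dual Y)"
  proof (intro exI conjI)
    show "unique_hom_extension t \<sigma>"
      unfolding unique_hom_extension_def alg_hom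
      by (intro conjI allI impI ballI \<sigma>; elim conjE, rule mult_hom_eq[OF \<sigma>])
    show "unique_hom_extension (dual t) \<sigma>_dual"
      unfolding unique_hom_extension_def alg_hom dual_dual
      by (intro conjI allI impI ballI \<sigma>_dual; elim conjE,
          rule mult_hom_eq[of _ "dual t" \<sigma>_dual, unfolded dual_dual, OF \<sigma>_dual])
    show "algebra_iso (H t) (H (dual t)) \<sigma>"
      unfolding algebra_iso_def alg_hom using \<sigma>(1) duality(1)[OF _ \<sigma> \<sigma>_dual] by simp
    show "\<forall>Y\<in>H (dual t). inv_into (H t) \<sigma> Y = \<sigma>_dual Y"
      using duality(2)[OF _ \<sigma> \<sigma>_dual] by simp
  qed
next
  have alg_antihom: "algebra_antihom A B = mult_hom (\<lambda>X Y. Y \<circ> X) A B" for A B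
    by (simp add: fun_eq_iff algebra_antihom_def mult_hom_def)
  obtain \<psi> where \<psi>: "mult_hom (\<lambda>X Y. Y \<circ> X) (H t) (H (dual t)) \<psi>" "duality_values t \<psi>"
    using duality_antihom_exists[of t] by (elim exE conjE)
  obtain \<psi>_dual where \<psi>_dual:
    "mult_hom (\<lambda>X Y. Y \<circ> X) (H (dual t)) (H t) \<psi>_dual" "duality_values (dual t) \<psi>_dual"
    using duality_antihom_exists[of "dual t", unfolded dual_dual] by (elim exE conjE)
  show "\<exists>\<psi> \<psi>_dual.
            unique_antihom_extension t \<psi> \<and> algebra_antiiso (H t) (H (dual t)) \<psi> \<and>
            unique_antihom_extension (dual t) \<psi>_dual \<and>
            (\<forall>Y\<in>H (dual t). inv_into (H t) \<psi> Y = \<psi>_dual Y)"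
  proof (intro exI conjI)
    show "unique_antihom_extension t \<psi>"
      unfolding unique_antihom_extension_def alg_antihom
      by (intro conjI allI impI ballI \<psi>; elim conjE, rule mult_hom_eq[OF \<psi>])
    show "unique_antihom_extension (dual t) \<psi>_dual"
      unfolding unique_antihom_extension_def alg_antihom dual_dual
      by (intro conjI allI impI ballI \<psi>_dual; elim conjE,
          rule mult_hom_eq[of _ "dual t" \<psi>_dual, unfolded dual_dual, OF \<psi>_dual])
    show "algebra_antiiso (H t) (H (dual t)) \<psi>"
      unfolding algebra_antiiso_def alg_antihom using \<psi>(1) duality(1)[OF _ \<psi> \<psi>_dual] by simp
    show "\<forall>Y\<in>H (dual t). inv_into (H t) \<psi> Y = \<psi>_dual Y"
      using duality(2)[OF _ \<psi> \<psi>_dual] by simp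
  qed
qed

end
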